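(* Let $M$ be a positive integer. Then $\sigma(M) = 2M - 1$ if and only if $$\frac{2M}{M+1} \leq I(M) < \frac{2M+1}{M+1}.$$
   Context: For a positive integer $n$, $\sigma(n)$ denotes the sum of the positive divisors of $n$, and $I(n) = \sigma(n)/n$ is the abundancy index of $n$. *)

theory Defs
  imports Complex_Main
begin

(* Junk value: the divisors of 0 are infinitely many, so divisor_sigma 0 = 0. *)
definition divisor_sigma :: "nat \<Rightarrow> nat" where
  "divisor_sigma n = (\<Sum>d | d dvd n. d)"

definition abundancy_index :: "nat \<Rightarrow> real" where
  "abundancy_index n = real (divisor_sigma n) / real n"

end

theory Submission
  imports Defs
begin

text \<open>Clearing denominators, the bounds become
  \<open>2 M\<^sup>2 \<le> (M + 1) \<sigma>(M) < 2 M\<^sup>2 + M\<close>, that is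
  \<open>(M + 1) (2 M - 2) + 2 \<le> (M + 1) \<sigma>(M) < (M + 1) (2 M - 1) + 1\<close>,
  and the only multiple of \<open>M + 1\<close> in this range is \<open>(M + 1) (2 M - 1)\<close>.\<close>

lemma unique_multiple_of_Suc:
  fixes m s :: int
  assumes "m > 0"
  shows "s = 2 * m - 1 \<longleftrightarrow> 2 * m * m \<le> s * (m + 1) \<and> s * (m + 1) < (2 * m + 1) * m"
proof
  assume "s = 2 * m - 1"
  show "2 * m * m \<le> s * (m + 1) \<and> s * (m + 1) < (2 * m + 1) * m"
    \<comment> \<open>The product is \<open>2 * m * m + m - 1\<close>: one below the upper bound,
      and at least the lower bound as \<open>m \<ge> 1\<close>.\<close>
    unfolding \<open>s = 2 * m - 1\<close> using assms by (simp add: algebra_simps)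
next
  assume bounds: "2 * m * m \<le> s * (m + 1) \<and> s * (m + 1) < (2 * m + 1) * m"
  \<comment> \<open>The left side is \<open>2 * m * m - 2\<close>.\<close>
  then have "(2 * m - 2) * (m + 1) < s * (m + 1)"
    by (simp add: algebra_simps)
  then have "2 * m - 2 < s"
    using assms by simp
  \<comment> \<open>The right side exceeds the upper bound by \<open>m\<close>.\<close>
  moreover have "s * (m + 1) < (2 * m) * (m + 1)"
    using bounds assms by (simp add: algebra_simps)
  then have "s < 2 * m"
    using assms by (simp only: mult_less_cancel_right)
  ultimately show "s = 2 * m - 1"
    by simp
qed

theorem theorem2:
  fixes M :: nat
  assumes "M > 0"
  shows "int (divisor_sigma M) = 2 * int M - 1 \<longleftrightarrow>
    2 * real M / (real M + 1) \<le> abundancy_index M \<and>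
    abundancy_index M < (2 * real M + 1) / (real M + 1)"
proof -
  let ?m = "int M" and ?s = "int (divisor_sigma M)"
  \<comment> \<open>Both sides are cast from \<open>int\<close> as a whole, so that the real
    inequalities reduce to the integer ones, where \<open>s\<close> is pinned down by
    discreteness.\<close>
  have "2 * real M / (real M + 1) \<le> abundancy_index M \<longleftrightarrow>
      real_of_int (2 * ?m * ?m) \<le> real_of_int (?s * (?m + 1))"
    using assms by (simp add: abundancy_index_def divide_simps)
  moreover have "abundancy_index M < (2 * real M + 1) / (real M + 1) \<longleftrightarrow>
      real_of_int (?s * (?m + 1)) < real_of_int ((2 * ?m + 1) * ?m)"
    using assms by (simp add: abundancy_index_def divide_simps)
  ultimately show ?thesis
    using unique_multiple_of_Suc[of ?m ?s] assms
    by (simp only: of_int_le_iff of_int_less_iff of_nat_0_less_iff)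
qed

end
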